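(* Let $n\ge 2$, let $S\subseteq\mathbb{R}^n$ be a compact body, and let $f:\mathbb{R}^n\to\mathbb{R}$ be integrable with $\mathrm{supp}(f)\subseteq S$ and $\int f\,dx=0$. Then for every $\epsilon>0$ there exists an $\epsilon$-thin decomposition $\mathcal{P}$ of $S$ such that each part $P\in\mathcal{P}$ is obtained from $S$ by successive halfspace cuts (i.e. $P$ is the closure of the interior of $S\cap H_1\cap\cdots\cap H_m$ for some closed halfspaces $H_1,\dots,H_m$) and satisfies $\int_P f\,dx=0$.
   Context: A compact body is a compact set $S\subseteq\mathbb{R}^n$ with nonempty interior such that $S$ equals the closure of its interior. A decomposition of a compact body $S$ is a finite collection $\mathcal{P}=\{P_1,\dots,P_k\}$ of compact bodies with $S=\bigcup_i P_i$ and $P_i\cap P_j=\partial P_i\cap\partial P_j$ for $i\ne j$. A decomposition is $\epsilon$-thin if each $P\in\mathcal{P}$ is contained in a (solid circular) cylinder of radius at most $\epsilon$. *)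

theory Defs
  imports "HOL-Analysis.Analysis"
begin

definition compact_body :: "'a::euclidean_space set \<Rightarrow> bool" where
  "compact_body S \<longleftrightarrow> compact S \<and> interior S \<noteq> {} \<and> S = closure (interior S)"

definition decomposition :: "'a::euclidean_space set set \<Rightarrow> 'a set \<Rightarrow> bool" where
  "decomposition \<P> S \<longleftrightarrow> finite \<P> \<and> (\<forall>P\<in>\<P>. compact_body P) \<and> \<Union>\<P> = S \<and>
     (\<forall>P\<in>\<P>. \<forall>Q\<in>\<P>. P \<noteq> Q \<longrightarrow> P \<inter> Q = frontier P \<inter> frontier Q)"

definition cylinder :: "'a::euclidean_space \<Rightarrow> 'a \<Rightarrow> real \<Rightarrow> 'a set" where
  "cylinder a u r = {x. \<exists>t::real. dist x (a + t *\<^sub>R u) \<le> r}"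

definition eps_thin :: "real \<Rightarrow> 'a::euclidean_space set set \<Rightarrow> bool" where
  "eps_thin \<epsilon> \<P> \<longleftrightarrow> (\<forall>P\<in>\<P>. \<exists>a u r. norm u = 1 \<and> r \<le> \<epsilon> \<and> P \<subseteq> cylinder a u r)"

definition closed_halfspace :: "'a::euclidean_space set \<Rightarrow> bool" where
  "closed_halfspace H \<longleftrightarrow> (\<exists>a b. a \<noteq> 0 \<and> H = {x. inner a x \<le> b})"

definition halfspace_cut_of :: "'a::euclidean_space set \<Rightarrow> 'a set \<Rightarrow> bool" where
  "halfspace_cut_of S P \<longleftrightarrow> (\<exists>Hs. (\<forall>H\<in>set Hs. closed_halfspace H) \<and>
      P = closure (interior (S \<inter> \<Inter>(set Hs))))"

end

theory Submission
  imports Defs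
begin

text \<open>
  Through every codimension-two affine subspace \<open>c + {i, j}\<^sup>\<bottom>\<close> passes a hyperplane
  bisecting \<open>f\<close> on a given cell, by the intermediate value theorem applied to a rotating halfspace.
  Performing these bisections for all pairs of coordinate directions \<open>i\<close>, \<open>j\<close> and all points \<open>c\<close> of a
  fine finite net makes the cells thin: given three points of \<open>S\<close> in one cell, the centroid of the
  triangle is close to some \<open>c\<close>, and since the triangle lies on one side of a hyperplane through
  \<open>c\<close>, its projection to each coordinate plane is almost degenerate. Hence all 2 by 2 minors of the edge
  vectors are small, and by Lagrange's identity the third point is close to the line through the
  other two.
\<close>

section \<open>Closures of open sets\<close>

lemma closure_interior_closure_open:
  assumes "open U"
  shows "closure (interior (closure U)) = closure U"
proof (rule antisym)
  show "closure (interior (closure U)) \<subseteq> closure U"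
    by (intro closure_minimal interior_subset closed_closure)
  show "closure U \<subseteq> closure (interior (closure U))"
    by (intro closure_mono interior_maximal closure_subset assms)
qed

lemma compact_body_closure_open:
  assumes "open U" "bounded U" "U \<noteq> {}"
  shows "compact_body (closure U)"
proof -
  have "U \<subseteq> interior (closure U)"
    using assms(1) by (simp add: closure_subset interior_maximal)
  then show ?thesis
    using assms closure_interior_closure_open[of U]
    by (auto simp: compact_body_def)
qed

text \<open>An open set missing a set also misses its closure. This is used twice: once to replace
  \<open>U\<close> by its closure, then, with the open set \<open>interior (closure U)\<close>, to
  replace \<open>V\<close> by its closure.\<close>

lemma interior_closure_Int_closure_disjoint:
  assumes "open U" "open V" "U \<inter> V = {}"
  shows "interior (closure U) \<inter> closure V = {}"
proof -
  have "closure U \<inter> V = {}"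
    using assms by (metis inf_commute open_Int_closure_eq_empty)
  then have "interior (closure U) \<inter> V = {}"
    using interior_subset by blast
  then show ?thesis
    by (simp add: open_Int_closure_eq_empty)
qed

text \<open>Supplies the boundary condition of \<open>decomposition\<close>: neither closure meets
  the interior of the other, so common points lie on both frontiers.\<close>

lemma closure_Int_closure_eq_frontier:
  assumes "open U" "open V" "U \<inter> V = {}"
  shows "closure U \<inter> closure V = frontier (closure U) \<inter> frontier (closure V)"
proof -
  have "interior (closure U) \<inter> closure V = {}" "interior (closure V) \<inter> closure U = {}"
    using interior_closure_Int_closure_disjoint[OF assms]
      interior_closure_Int_closure_disjoint[OF assms(2,1)] assms(3)
    by (simp_all add: Int_commute)
  then show ?thesis
    unfolding frontier_def closure_closure by blast
qed

section \<open>Partitions of space into polyhedral cells\<close>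

text \<open>The list has the shape that \<open>halfspace_cut_of\<close> asks for. Cells live in the
  whole space and are intersected with the body only at the end, so that they stay convex.\<close>

definition cell :: "'a::euclidean_space set \<Rightarrow> bool" where
  "cell C \<longleftrightarrow> (\<exists>Hs. (\<forall>H\<in>set Hs. closed_halfspace H) \<and> C = \<Inter>(set Hs))"

text \<open>Cells may share boundary points, and degenerate or empty cells are allowed, so a cut may
  leave nothing on one side.\<close>

definition cell_partition :: "'a::euclidean_space set set \<Rightarrow> bool" where
  "cell_partition \<C> \<longleftrightarrow> finite \<C> \<and> (\<forall>C\<in>\<C>. cell C) \<and> \<Union>\<C> = UNIV \<and>
     (\<forall>C\<in>\<C>. \<forall>D\<in>\<C>. C \<noteq> D \<longrightarrow> interior C \<inter> interior D = {})"

lemma cell_UNIV: "cell UNIV"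
  unfolding cell_def by (rule exI[of _ "[]"]) simp

lemma cell_Int_halfspace:
  assumes "cell C" "a \<noteq> 0"
  shows "cell (C \<inter> {x. a \<bullet> x \<le> b})"
proof -
  obtain Hs where "\<forall>H\<in>set Hs. closed_halfspace H" "C = \<Inter>(set Hs)"
    using assms by (auto simp: cell_def)
  then show ?thesis
    unfolding cell_def using assms(2)
    by (intro exI[of _ "{x. a \<bullet> x \<le> b} # Hs"]) (auto simp: closed_halfspace_def)
qed

lemma
  assumes "cell C"
  shows cell_closed: "closed C" and cell_convex: "convex C"
proof -
  obtain Hs where "\<forall>H\<in>set Hs. closed_halfspace H" "C = \<Inter>(set Hs)"
    using assms by (auto simp: cell_def)
  then show "closed C" "convex C"
    by (auto simp: closed_halfspace_def intro!: closed_Inter convex_Inter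
        closed_halfspace_le convex_halfspace_le)
qed

lemma cell_negligible_frontier: "cell C \<Longrightarrow> negligible (frontier C)"
  by (simp add: cell_convex negligible_convex_frontier)

lemma cell_partition_UNIV: "cell_partition {UNIV}"
  by (simp add: cell_partition_def cell_UNIV)

text \<open>Each cell may be cut by its own hyperplane. The far side is written with negated normal
  and offset, which makes it a closed halfspace of the same form.\<close>

lemma cell_partition_split:
  fixes a :: "'a::euclidean_space set \<Rightarrow> 'a" and b :: "'a set \<Rightarrow> real"
  assumes "cell_partition \<C>" "\<And>C. C \<in> \<C> \<Longrightarrow> a C \<noteq> 0"
  shows "cell_partition ((\<lambda>C. C \<inter> {x. a C \<bullet> x \<le> b C}) ` \<C> \<union> (\<lambda>C. C \<inter> {x. (- a C) \<bullet> x \<le> - b C}) ` \<C>)"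
proof -
  let ?H = "\<lambda>C. C \<inter> {x. a C \<bullet> x \<le> b C}" and ?K = "\<lambda>C. C \<inter> {x. (- a C) \<bullet> x \<le> - b C}"
  have disj: "interior (?H C) \<inter> interior (?K C) = {}" if "C \<in> \<C>" for C
    using assms(2)[OF that] interior_halfspace_le[of "a C" "b C"]
      interior_halfspace_le[of "- a C" "- b C"] by auto
  have sub: "interior (?H C) \<subseteq> interior C" "interior (?K C) \<subseteq> interior C" for C
    by auto
  have sep: "interior C \<inter> interior D = {}" if "C \<in> \<C>" "D \<in> \<C>" "C \<noteq> D" for C D
    using assms(1) that by (auto simp: cell_partition_def)
  have sep': "interior X \<inter> interior Y = {}"
    if "X \<in> ?H ` \<C> \<union> ?K ` \<C>" "Y \<in> ?H ` \<C> \<union> ?K ` \<C>" "X \<noteq> Y" for X Y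
  proof -
    obtain C where C: "C \<in> \<C>" "X = ?H C \<or> X = ?K C" using \<open>X \<in> _\<close> by blast
    obtain D where D: "D \<in> \<C>" "Y = ?H D \<or> Y = ?K D" using \<open>Y \<in> _\<close> by blast
    show ?thesis
    \<comment> \<open>Two different pieces are either the two sides of one cell, or they lie in two
      cells whose interiors are already disjoint.\<close>
    proof (cases "C = D")
      case True
      then show ?thesis using C D disj[OF C(1)] \<open>X \<noteq> Y\<close> by blast
    next
      case False
      then show ?thesis using C(2) D(2) sep[OF C(1) D(1)] sub[of C] sub[of D] by blast
    qed
  qed
  have cover: "\<Union>(?H ` \<C> \<union> ?K ` \<C>) = UNIV"
  proof -
    have split: "?H C \<union> ?K C = C" for C
      by auto
    have "\<Union>(?H ` \<C> \<union> ?K ` \<C>) = (\<Union>C\<in>\<C>. ?H C \<union> ?K C)"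
      by (simp only: Union_Un_distrib UN_Un_distrib)
    also have "\<dots> = \<Union>\<C>"
      by (simp only: split image_ident)
    finally show ?thesis using assms(1) by (simp add: cell_partition_def)
  qed
  have cells: "cell X" if "X \<in> ?H ` \<C> \<union> ?K ` \<C>" for X
  proof -
    from that obtain C where C: "C \<in> \<C>" "X = ?H C \<or> X = ?K C" by blast
    have "cell C" using C(1) assms(1) by (simp add: cell_partition_def)
    then have "cell (?H C)" "cell (?K C)"
      using assms(2)[OF C(1)] by (intro cell_Int_halfspace; simp)+
    then show ?thesis using C(2) by blast
  qed
  have "finite (?H ` \<C> \<union> ?K ` \<C>)"
    using assms(1) by (simp add: cell_partition_def)
  then show ?thesis
    unfolding cell_partition_def by (intro conjI ballI impI cells cover sep')
qed

section \<open>Bisecting a function by a rotating halfspace\<close>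

lemma closed_imp_sets_lebesgue: "closed C \<Longrightarrow> C \<in> sets lebesgue"
  by (simp add: borel_closed)

lemma AE_not_in_negligible: "negligible N \<Longrightarrow> AE x in lebesgue. x \<notin> N"
  by (simp add: AE_not_in negligible_iff_null_sets)

text \<open>The two closed sides overlap only in a hyperplane, which is a null set.\<close>

lemma set_lebesgue_integral_split_halfspace:
  fixes f :: "'a::euclidean_space \<Rightarrow> real"
  assumes f: "integrable lebesgue f" and C: "closed C" and a: "a \<noteq> 0"
  shows "(LINT x:C \<inter> {x. a \<bullet> x \<le> b}|lebesgue. f x) + (LINT x:C \<inter> {x. (- a) \<bullet> x \<le> - b}|lebesgue. f x)
    = (LINT x:C|lebesgue. f x)"
proof -
  let ?H = "C \<inter> {x. a \<bullet> x \<le> b}" and ?K = "C \<inter> {x. (- a) \<bullet> x \<le> - b}"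
  have m: "?H \<in> sets lebesgue" "?K \<in> sets lebesgue"
    by (intro closed_imp_sets_lebesgue closed_Int C closed_halfspace_le)+
  have "AE x in lebesgue. x \<notin> {x. a \<bullet> x = b}"
    using a by (intro AE_not_in_negligible negligible_hyperplane) auto
  then have "AE x in lebesgue. \<not> (x \<in> ?H \<and> x \<in> ?K)"
    by eventually_elim auto
  then have "(LINT x:?H \<union> ?K|lebesgue. f x) = (LINT x:?H|lebesgue. f x) + (LINT x:?K|lebesgue. f x)"
    using m by (intro set_integral_Un_AE)
      (auto simp only: set_integrable_def intro: integrable_mult_indicator f)
  moreover have "?H \<union> ?K = C" by auto
  ultimately show ?thesis by simp
qed

text \<open>Dominated convergence with majorant \<open>norm (f x)\<close>: the indicators converge
  at every point off the limiting hyperplane.\<close>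

lemma continuous_set_lebesgue_integral_halfspace:
  fixes f :: "'a::euclidean_space \<Rightarrow> real" and a :: "real \<Rightarrow> 'a"
  assumes f: "integrable lebesgue f" and C: "closed C"
    and a: "continuous_on UNIV a" "\<And>t. a t \<noteq> 0"
  shows "continuous_on UNIV (\<lambda>t. LINT x:C \<inter> {x. a t \<bullet> x \<le> a t \<bullet> c}|lebesgue. f x)"
  unfolding continuous_on_sequentially
proof (intro allI ballI impI, elim conjE)
  fix u :: "nat \<Rightarrow> real" and t
  assume "u \<longlonglongrightarrow> t"
  let ?H = "\<lambda>t. C \<inter> {x. a t \<bullet> x \<le> a t \<bullet> c}"
  have m: "?H t \<in> sets lebesgue" for t
    by (intro closed_imp_sets_lebesgue closed_Int C closed_halfspace_le)
  have fm: "f \<in> borel_measurable lebesgue" using f by auto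
  have au: "(\<lambda>n. a (u n)) \<longlonglongrightarrow> a t"
    by (rule continuous_on_tendsto_compose[OF a(1) \<open>u \<longlonglongrightarrow> t\<close>]) auto
  have "AE x in lebesgue. x \<notin> {x. a t \<bullet> x = a t \<bullet> c}"
    using a by (intro AE_not_in_negligible negligible_hyperplane) auto
  then have lim: "AE x in lebesgue. (\<lambda>n. indicator (?H (u n)) x *\<^sub>R f x) \<longlonglongrightarrow> indicator (?H t) x *\<^sub>R f x"
  proof eventually_elim
    case (elim x)
    have l: "(\<lambda>n. a (u n) \<bullet> x - a (u n) \<bullet> c) \<longlonglongrightarrow> a t \<bullet> x - a t \<bullet> c"
      by (intro tendsto_intros au)
    \<comment> \<open>Off the limiting hyperplane the sign of the limit is strict, hence shared by
      all late terms, so the indicators are eventually constant.\<close>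
    have "\<forall>\<^sub>F n in sequentially. (a (u n) \<bullet> x \<le> a (u n) \<bullet> c) = (a t \<bullet> x \<le> a t \<bullet> c)"
    proof (cases "a t \<bullet> x - a t \<bullet> c < 0")
      case True
      show ?thesis using order_tendstoD(2)[OF l True] by eventually_elim (use True in auto)
    next
      case False
      then have "0 < a t \<bullet> x - a t \<bullet> c" using elim by auto
      from order_tendstoD(1)[OF l this] show ?thesis by eventually_elim (use False elim in auto)
    qed
    then have "\<forall>\<^sub>F n in sequentially. indicator (?H (u n)) x *\<^sub>R f x = indicator (?H t) x *\<^sub>R f x"
      by eventually_elim (auto simp: indicator_def)
    then show ?case by (rule tendsto_eventually)
  qed
  show "((\<lambda>t. LINT x:?H t|lebesgue. f x) \<circ> u) \<longlonglongrightarrow> (LINT x:?H t|lebesgue. f x)"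
    unfolding comp_def set_lebesgue_integral_def
  proof (rule integral_dominated_convergence[where w = "\<lambda>x. norm (f x)"])
    show "AE x in lebesgue. norm (indicator (?H (u n)) x *\<^sub>R f x) \<le> norm (f x)" for n
      by (auto simp: indicator_def)
  qed (use f fm m lim in \<open>auto intro!: borel_measurable_scaleR borel_measurable_indicator\<close>)
qed

text \<open>For distinct \<open>i\<close>, \<open>j\<close> in \<open>Basis\<close> this runs
  through the unit circle of their plane. The hyperplanes through \<open>c\<close> with these
  normals are those containing the codimension-two subspace through \<open>c\<close> orthogonal to
  \<open>i\<close> and \<open>j\<close>.\<close>

definition rotating_normal :: "'a::euclidean_space \<Rightarrow> 'a \<Rightarrow> real \<Rightarrow> 'a" where
  "rotating_normal i j t = cos t *\<^sub>R i + sin t *\<^sub>R j"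

lemma norm_rotating_normal:
  assumes "i \<in> Basis" "j \<in> Basis" "i \<noteq> j"
  shows "norm (rotating_normal i j t) = 1"
proof -
  have "rotating_normal i j t \<bullet> rotating_normal i j t = (cos t)\<^sup>2 + (sin t)\<^sup>2"
    using assms by (simp add: rotating_normal_def inner_simps inner_Basis power2_eq_square)
  then show ?thesis by (simp add: norm_eq_sqrt_inner)
qed

lemma rotating_normal_nonzero:
  "i \<in> Basis \<Longrightarrow> j \<in> Basis \<Longrightarrow> i \<noteq> j \<Longrightarrow> rotating_normal i j t \<noteq> 0"
  using norm_rotating_normal[of i j t] by (metis norm_zero zero_neq_one)

text \<open>A half turn replaces the halfspace by the opposite one, so the integrals at angles
  \<open>0\<close> and \<open>pi\<close> add up to the integral over \<open>C\<close>, which is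
  zero. They have opposite signs or both vanish, and the intermediate value theorem gives an
  angle.\<close>

lemma exists_bisecting_rotation:
  fixes f :: "'a::euclidean_space \<Rightarrow> real"
  assumes f: "integrable lebesgue f" and C: "closed C" and zero: "(LINT x:C|lebesgue. f x) = 0"
    and ij: "i \<in> Basis" "j \<in> Basis" "i \<noteq> j"
  obtains t where "(LINT x:C \<inter> {x. rotating_normal i j t \<bullet> x \<le> rotating_normal i j t \<bullet> c}|lebesgue. f x) = 0"
proof -
  let ?a = "rotating_normal i j"
  define F where "F t = (LINT x:C \<inter> {x. ?a t \<bullet> x \<le> ?a t \<bullet> c}|lebesgue. f x)" for t
  have "continuous_on UNIV ?a"
    unfolding rotating_normal_def by (intro continuous_intros)
  then have cont: "continuous_on UNIV F"
    unfolding F_def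
    by (intro continuous_set_lebesgue_integral_halfspace[OF f C] rotating_normal_nonzero ij)
  have "?a pi = - ?a 0"
    by (simp add: rotating_normal_def)
  then have sum: "F 0 + F pi = 0"
    using set_lebesgue_integral_split_halfspace[OF f C rotating_normal_nonzero[OF ij], of 0 "?a 0 \<bullet> c"] zero
    by (simp add: F_def)
  have "\<exists>t. F t = 0"
  proof (cases "F 0 \<le> 0")
    case True
    then have "0 \<le> F pi" using sum by linarith
    then show ?thesis
      using IVT'[of F 0 0 pi] True continuous_on_subset[OF cont] by auto
  next
    case False
    then have "F pi \<le> 0" using sum by linarith
    then show ?thesis
      using IVT2'[of F pi 0 0] False continuous_on_subset[OF cont] by auto
  qed
  then show ?thesis using that by (auto simp: F_def)
qed

text \<open>Induction on the demands in \<open>G\<close>: each new triple cuts all current cells by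
  bisecting hyperplanes through its point. Lying on one side of a hyperplane passes to subsets, so
  earlier demands survive later cuts.\<close>

lemma exists_bisecting_cell_partition:
  fixes f :: "'a::euclidean_space \<Rightarrow> real"
  assumes f: "integrable lebesgue f" and zero: "(\<integral>x. f x \<partial>lebesgue) = 0"
    and "finite G" and "\<And>i j c. (i, j, c) \<in> G \<Longrightarrow> i \<in> Basis \<and> j \<in> Basis \<and> i \<noteq> j"
  shows "\<exists>\<C>. cell_partition \<C> \<and> (\<forall>C\<in>\<C>. (LINT x:C|lebesgue. f x) = 0) \<and>
    (\<forall>C\<in>\<C>. \<forall>(i, j, c)\<in>G. \<exists>t. \<forall>x\<in>C. rotating_normal i j t \<bullet> x \<le> rotating_normal i j t \<bullet> c)"
  using assms(3,4)
proof (induction G rule: finite_induct)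
  case empty
  show ?case
    by (rule exI[of _ "{UNIV}"])
      (use zero in \<open>simp add: cell_partition_UNIV set_lebesgue_integral_def\<close>)
next
  case (insert g G)
  obtain i j c where g: "g = (i, j, c)" by (cases g)
  have ij: "i \<in> Basis" "j \<in> Basis" "i \<noteq> j" using insert.prems[of i j c] g by auto
  obtain \<C> where part: "cell_partition \<C>"
    and int0: "\<And>C. C \<in> \<C> \<Longrightarrow> (LINT x:C|lebesgue. f x) = 0"
    and old: "\<And>C i j c. C \<in> \<C> \<Longrightarrow> (i, j, c) \<in> G \<Longrightarrow>
      \<exists>t. \<forall>x\<in>C. rotating_normal i j t \<bullet> x \<le> rotating_normal i j t \<bullet> c"
    using insert.IH insert.prems by fastforce
  have closed: "closed C" if "C \<in> \<C>" for C
    using part that cell_closed by (auto simp: cell_partition_def)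
  have "\<forall>C\<in>\<C>. \<exists>t. (LINT x:C \<inter> {x. rotating_normal i j t \<bullet> x \<le> rotating_normal i j t \<bullet> c}|lebesgue. f x) = 0"
    using exists_bisecting_rotation[OF f closed int0 ij] by metis
  then obtain t where t: "\<And>C. C \<in> \<C> \<Longrightarrow>
      (LINT x:C \<inter> {x. rotating_normal i j (t C) \<bullet> x \<le> rotating_normal i j (t C) \<bullet> c}|lebesgue. f x) = 0"
    by metis
  define a where "a C = rotating_normal i j (t C)" for C
  define b where "b C = a C \<bullet> c" for C
  let ?H = "\<lambda>C. C \<inter> {x. a C \<bullet> x \<le> b C}" and ?K = "\<lambda>C. C \<inter> {x. (- a C) \<bullet> x \<le> - b C}"
  have a0: "a C \<noteq> 0" for C
    unfolding a_def by (rule rotating_normal_nonzero[OF ij])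
  \<comment> \<open>The far side also satisfies the demanded inequality, with the angle advanced by
    \<open>pi\<close>.\<close>
  have minus_a: "- a C = rotating_normal i j (t C + pi)" for C
    by (simp add: a_def rotating_normal_def)
  have H0: "(LINT x:?H C|lebesgue. f x) = 0" if "C \<in> \<C>" for C
    using t[OF that] by (simp add: a_def b_def)
  have K0: "(LINT x:?K C|lebesgue. f x) = 0" if "C \<in> \<C>" for C
    using set_lebesgue_integral_split_halfspace[OF f closed[OF that] a0, of C "b C"]
      H0[OF that] int0[OF that] by simp
  have new: "\<exists>t. \<forall>x\<in>X. rotating_normal i j t \<bullet> x \<le> rotating_normal i j t \<bullet> c"
    if "X \<in> ?H ` \<C> \<union> ?K ` \<C>" for X
  proof -
    from that obtain C where "X = ?H C \<or> X = ?K C" by blast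
    then show ?thesis
    proof
      assume "X = ?H C"
      then show ?thesis by (intro exI[of _ "t C"]) (auto simp: a_def b_def)
    next
      assume "X = ?K C"
      then show ?thesis
        by (intro exI[of _ "t C + pi"]) (auto simp flip: minus_a simp: b_def)
    qed
  qed
  have keep: "\<exists>t. \<forall>x\<in>X. rotating_normal i' j' t \<bullet> x \<le> rotating_normal i' j' t \<bullet> c'"
    if "X \<in> ?H ` \<C> \<union> ?K ` \<C>" "(i', j', c') \<in> G" for X i' j' c'
  proof -
    from that(1) obtain C where "C \<in> \<C>" "X \<subseteq> C" by blast
    then show ?thesis using old[OF _ that(2)] by blast
  qed
  show ?case
  proof (intro exI[of _ "?H ` \<C> \<union> ?K ` \<C>"] conjI)
    show "cell_partition (?H ` \<C> \<union> ?K ` \<C>)"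
      by (rule cell_partition_split[OF part a0])
    show "\<forall>X\<in>?H ` \<C> \<union> ?K ` \<C>. (LINT x:X|lebesgue. f x) = 0"
      using H0 K0 by blast
    show "\<forall>X\<in>?H ` \<C> \<union> ?K ` \<C>. \<forall>(i, j, c)\<in>insert g G.
        \<exists>t. \<forall>x\<in>X. rotating_normal i j t \<bullet> x \<le> rotating_normal i j t \<bullet> c"
      unfolding g by (auto simp only: insert_iff prod.inject intro: new keep)
  qed
qed

section \<open>Thinness\<close>

text \<open>Cramer's rule: the inner products of the normal with \<open>B\<close> and
  \<open>Z\<close> form a linear system for \<open>cos t\<close> and \<open>sin t\<close> whose
  determinant is the minor. Small right-hand sides force a small determinant, as
  \<open>cos t\<close> and \<open>sin t\<close> cannot both be small.\<close>

lemma minor_le_of_separated: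
  fixes B Z :: "'a::euclidean_space"
  assumes "\<bar>rotating_normal i j t \<bullet> B\<bar> \<le> d" "\<bar>rotating_normal i j t \<bullet> Z\<bar> \<le> d"
    and ij: "i \<in> Basis" "j \<in> Basis" and "norm B \<le> r" "norm Z \<le> r"
  shows "\<bar>(B \<bullet> i) * (Z \<bullet> j) - (B \<bullet> j) * (Z \<bullet> i)\<bar> \<le> 4 * d * r"
proof -
  let ?D = "(B \<bullet> i) * (Z \<bullet> j) - (B \<bullet> j) * (Z \<bullet> i)"
  define e1 e2 where "e1 = rotating_normal i j t \<bullet> B" and "e2 = rotating_normal i j t \<bullet> Z"
  have e: "\<bar>e1\<bar> \<le> d" "\<bar>e2\<bar> \<le> d" using assms by (auto simp: e1_def e2_def)
  have comp: "\<bar>B \<bullet> i\<bar> \<le> r" "\<bar>B \<bullet> j\<bar> \<le> r" "\<bar>Z \<bullet> i\<bar> \<le> r" "\<bar>Z \<bullet> j\<bar> \<le> r"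
    using ij assms Basis_le_norm order_trans by blast+
  have prod: "\<bar>x * y\<bar> \<le> d * r" if "\<bar>x\<bar> \<le> d" "\<bar>y\<bar> \<le> r" for x y :: real
    unfolding abs_mult using that by (intro mult_mono) auto
  have c: "cos t * ?D = e1 * (Z \<bullet> j) - e2 * (B \<bullet> j)" and s: "sin t * ?D = e2 * (B \<bullet> i) - e1 * (Z \<bullet> i)"
    by (simp_all add: e1_def e2_def rotating_normal_def inner_simps inner_commute algebra_simps)
  have "\<bar>cos t * ?D\<bar> \<le> 2 * d * r" "\<bar>sin t * ?D\<bar> \<le> 2 * d * r"
    unfolding c s
    using prod[OF e(1) comp(4)] prod[OF e(2) comp(2)] prod[OF e(2) comp(1)] prod[OF e(1) comp(3)]
    by linarith+
  \<comment> \<open>Adding the two bounds \<open>2 * d * r\<close> with this inequality gives the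
    constant 4.\<close>
  moreover have "1 \<le> \<bar>cos t\<bar> + \<bar>sin t\<bar>"
  proof -
    have "(1::real)\<^sup>2 \<le> (\<bar>cos t\<bar> + \<bar>sin t\<bar>)\<^sup>2"
      using sin_cos_squared_add[of t] by (simp add: power2_sum)
    then show ?thesis by (rule power2_le_imp_le) simp
  qed
  then have "1 * \<bar>?D\<bar> \<le> (\<bar>cos t\<bar> + \<bar>sin t\<bar>) * \<bar>?D\<bar>"
    by (rule mult_right_mono) simp
  ultimately show ?thesis
    unfolding abs_mult distrib_right by linarith
qed

text \<open>Expanding the square separates the double sums into products of inner products. The
  factor 2 appears because the sum runs over ordered pairs.\<close>

lemma Lagrange_identity:
  fixes x y :: "'a::euclidean_space"
  shows "(\<Sum>i\<in>Basis. \<Sum>j\<in>Basis. ((x \<bullet> i) * (y \<bullet> j) - (x \<bullet> j) * (y \<bullet> i))\<^sup>2)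
    = 2 * ((x \<bullet> x) * (y \<bullet> y) - (x \<bullet> y)\<^sup>2)"
proof -
  have "(\<Sum>i\<in>Basis. \<Sum>j\<in>Basis. ((x \<bullet> i) * (y \<bullet> j) - (x \<bullet> j) * (y \<bullet> i))\<^sup>2)
    = (\<Sum>i\<in>Basis. \<Sum>j\<in>Basis. ((x \<bullet> i) * (x \<bullet> i)) * ((y \<bullet> j) * (y \<bullet> j)))
      + (\<Sum>i\<in>Basis. \<Sum>j\<in>Basis. ((y \<bullet> i) * (y \<bullet> i)) * ((x \<bullet> j) * (x \<bullet> j)))
      - 2 * (\<Sum>i\<in>Basis. \<Sum>j\<in>Basis. ((x \<bullet> i) * (y \<bullet> i)) * ((x \<bullet> j) * (y \<bullet> j)))"
    unfolding sum_distrib_left sum.distrib[symmetric] sum_subtractf[symmetric]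
    by (intro sum.cong refl) (simp add: power2_eq_square algebra_simps)
  also have "\<dots> = (x \<bullet> x) * (y \<bullet> y) + (y \<bullet> y) * (x \<bullet> x) - 2 * ((x \<bullet> y) * (x \<bullet> y))"
    unfolding sum_product[symmetric] euclidean_inner[symmetric] ..
  also have "\<dots> = 2 * ((x \<bullet> x) * (y \<bullet> y) - (x \<bullet> y)\<^sup>2)"
    by (simp add: power2_eq_square algebra_simps)
  finally show ?thesis .
qed

text \<open>The squared distance from \<open>z\<close> to the line through \<open>a\<close> and
  \<open>b\<close> is the Gram determinant of the edge vectors divided by the squared length of
  \<open>b - a\<close>. Here the numerator is at most \<open>e ^ 4\<close> and the denominator
  exceeds the square of \<open>e\<close>.\<close>

lemma dist_line_le:
  fixes a b z :: "'a::euclidean_space"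
  assumes "e > 0" "norm (b - a) > e"
    and "(norm (b - a))\<^sup>2 * (norm (z - a))\<^sup>2 - ((b - a) \<bullet> (z - a))\<^sup>2 \<le> e ^ 4"
  shows "z \<in> cylinder a ((b - a) /\<^sub>R norm (b - a)) e"
proof -
  define B Z where "B = b - a" and "Z = z - a"
  \<comment> \<open>The signed length of the orthogonal projection of \<open>Z\<close> onto the
    direction of \<open>B\<close>.\<close>
  define t where "t = (B \<bullet> Z) / norm B"
  have B: "norm B > e" "norm B > 0" using assms by (auto simp: B_def)
  have "(norm (Z - (t / norm B) *\<^sub>R B))\<^sup>2 = (norm Z)\<^sup>2 - 2 * (t / norm B) * (B \<bullet> Z) + (t / norm B)\<^sup>2 * (norm B)\<^sup>2"
    unfolding power2_norm_eq_inner
    by (simp add: inner_simps inner_commute algebra_simps power2_eq_square)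
  also have "\<dots> = (norm Z)\<^sup>2 - t\<^sup>2"
    using B by (simp add: t_def field_simps power2_eq_square)
  finally have eq: "(norm (Z - (t / norm B) *\<^sub>R B))\<^sup>2 = (norm Z)\<^sup>2 - t\<^sup>2" .
  have "(norm B)\<^sup>2 * ((norm Z)\<^sup>2 - t\<^sup>2) \<le> e ^ 4"
    using assms(3) B by (simp add: t_def B_def Z_def algebra_simps power_divide)
  also have "e ^ 4 = e\<^sup>2 * e\<^sup>2" by (simp flip: power_add)
  also have "\<dots> \<le> (norm B)\<^sup>2 * e\<^sup>2"
    using B assms(1) by (intro mult_right_mono power_mono) auto
  finally have "(norm (Z - (t / norm B) *\<^sub>R B))\<^sup>2 \<le> e\<^sup>2"
    unfolding eq using B by simp
  then have "norm (Z - (t / norm B) *\<^sub>R B) \<le> e"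
    by (rule power2_le_imp_le) (use assms(1) in simp)
  then have "dist z (a + t *\<^sub>R (B /\<^sub>R norm B)) \<le> e"
    by (simp add: dist_norm Z_def divide_inverse algebra_simps)
  then show ?thesis
    unfolding cylinder_def B_def by blast
qed

text \<open>If two points are more than \<open>e\<close> apart, the line through them is the axis:
  the squares of all \<open>DIM('a)\<close> times \<open>DIM('a)\<close> minors add up to at most
  \<open>e ^ 4\<close>. Otherwise \<open>K\<close> lies in a ball of radius \<open>e\<close> about
  any of its points, and any axis through that point works.\<close>

lemma subset_cylinder_of_small_minors:
  fixes K :: "'a::euclidean_space set"
  assumes e: "e > 0"
    and minors: "\<And>a b z i j. a \<in> K \<Longrightarrow> b \<in> K \<Longrightarrow> z \<in> K \<Longrightarrow> i \<in> Basis \<Longrightarrow> j \<in> Basis \<Longrightarrow>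
      \<bar>((b - a) \<bullet> i) * ((z - a) \<bullet> j) - ((b - a) \<bullet> j) * ((z - a) \<bullet> i)\<bar> \<le> e\<^sup>2 / DIM('a)"
  shows "\<exists>a u. norm u = 1 \<and> K \<subseteq> cylinder a u e"
proof (cases "\<exists>a\<in>K. \<exists>b\<in>K. norm (b - a) > e")
  case True
  then obtain a b where ab: "a \<in> K" "b \<in> K" "norm (b - a) > e" by blast
  have "z \<in> cylinder a ((b - a) /\<^sub>R norm (b - a)) e" if z: "z \<in> K" for z
  proof (rule dist_line_le[OF e ab(3)])
    let ?m = "\<lambda>i j. ((b - a) \<bullet> i) * ((z - a) \<bullet> j) - ((b - a) \<bullet> j) * ((z - a) \<bullet> i)"
    have "(?m i j)\<^sup>2 \<le> (e\<^sup>2 / DIM('a))\<^sup>2" if "i \<in> Basis" "j \<in> Basis" for i j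
      using power_mono[OF minors[OF ab(1,2) z that] abs_ge_zero, of 2] by simp
    then have "(\<Sum>i\<in>Basis. \<Sum>j\<in>Basis. (?m i j)\<^sup>2) \<le> (\<Sum>i\<in>(Basis::'a set). \<Sum>j\<in>(Basis::'a set). (e\<^sup>2 / DIM('a))\<^sup>2)"
      by (intro sum_mono)
    also have "\<dots> = e ^ 4"
      by (simp add: power2_eq_square power4_eq_xxxx)
    finally have "2 * ((norm (b - a))\<^sup>2 * (norm (z - a))\<^sup>2 - ((b - a) \<bullet> (z - a))\<^sup>2) \<le> e ^ 4"
      unfolding Lagrange_identity power2_norm_eq_inner .
    moreover have "0 \<le> e ^ 4" by simp
    \<comment> \<open>The factor 2 from Lagrange's identity is simply given away.\<close>
    moreover have "q \<le> s" if "2 * q \<le> s" "0 \<le> s" for q s :: real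
      using that by linarith
    ultimately show "(norm (b - a))\<^sup>2 * (norm (z - a))\<^sup>2 - ((b - a) \<bullet> (z - a))\<^sup>2 \<le> e ^ 4"
      by blast
  qed
  moreover have "norm ((b - a) /\<^sub>R norm (b - a)) = 1"
    unfolding norm_scaleR abs_inverse abs_norm_cancel
    using ab(3) e by (intro left_inverse) linarith
  ultimately show ?thesis by blast
next
  case False
  obtain u :: 'a where u: "u \<in> Basis" using nonempty_Basis by blast
  \<comment> \<open>The disjunction provides a base point for the axis even when \<open>K\<close> is
    empty.\<close>
  obtain a where a: "K = {} \<or> a \<in> K" by blast
  have "x \<in> cylinder a u e" if "x \<in> K" for x
    unfolding cylinder_def using False that a
    by (auto intro!: exI[of _ 0] simp: dist_norm not_less)
  then show ?thesis using u by (metis norm_Basis subsetI)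
qed

text \<open>The heights of \<open>a\<close>, \<open>b\<close>, \<open>z\<close> along the normal are
  at most that of \<open>c\<close>, which exceeds their mean by at most \<open>d\<close>. Their
  deficits are nonnegative with sum at most \<open>3 * d\<close>, so any two heights differ by at
  most \<open>3 * d\<close>. The minor bound with \<open>3 * d\<close> yields the constant
  12.\<close>

lemma minor_le_of_cut_near_centroid:
  fixes a b z c :: "'a::euclidean_space"
  assumes ij: "i \<in> Basis" "j \<in> Basis" "i \<noteq> j"
    and cut: "\<And>x. x \<in> {a, b, z} \<Longrightarrow> rotating_normal i j t \<bullet> x \<le> rotating_normal i j t \<bullet> c"
    and c: "dist ((1/3) *\<^sub>R (a + b + z)) c \<le> d"
    and r: "norm (b - a) \<le> r" "norm (z - a) \<le> r"
  shows "\<bar>((b - a) \<bullet> i) * ((z - a) \<bullet> j) - ((b - a) \<bullet> j) * ((z - a) \<bullet> i)\<bar> \<le> 12 * d * r"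
proof -
  let ?n = "rotating_normal i j t" and ?m = "(1/3) *\<^sub>R (a + b + z)"
  have "?n \<bullet> (c - ?m) \<le> norm ?n * norm (c - ?m)" by (rule norm_cauchy_schwarz)
  also have "\<dots> \<le> d"
    using c by (simp add: norm_rotating_normal[OF ij] dist_norm norm_minus_commute)
  finally have "?n \<bullet> c \<le> (?n \<bullet> a + ?n \<bullet> b + ?n \<bullet> z) / 3 + d"
    by (simp add: inner_simps)
  moreover have "?n \<bullet> a \<le> ?n \<bullet> c" "?n \<bullet> b \<le> ?n \<bullet> c" "?n \<bullet> z \<le> ?n \<bullet> c"
    using cut by auto
  ultimately have "\<bar>?n \<bullet> b - ?n \<bullet> a\<bar> \<le> 3 * d" "\<bar>?n \<bullet> z - ?n \<bullet> a\<bar> \<le> 3 * d"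
    by (auto simp: abs_le_iff field_simps)
  then have "\<bar>?n \<bullet> (b - a)\<bar> \<le> 3 * d" "\<bar>?n \<bullet> (z - a)\<bar> \<le> 3 * d"
    by (simp_all add: inner_diff_right)
  from minor_le_of_separated[OF this ij(1,2) r] show ?thesis by simp
qed

lemma exists_thin_bisecting_cell_partition:
  fixes f :: "'a::euclidean_space \<Rightarrow> real"
  assumes f: "integrable lebesgue f" and zero: "(\<integral>x. f x \<partial>lebesgue) = 0"
    and S: "bounded S" and e: "e > 0"
  shows "\<exists>\<C>. cell_partition \<C> \<and> (\<forall>C\<in>\<C>. (LINT x:C|lebesgue. f x) = 0) \<and>
    (\<forall>C\<in>\<C>. \<exists>a u. norm u = 1 \<and> S \<inter> C \<subseteq> cylinder a u e)"
proof -
  obtain R where R: "R > 0" "\<And>x. x \<in> S \<Longrightarrow> norm x \<le> R"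
    using S by (auto simp: bounded_pos)
  \<comment> \<open>Chosen so that \<open>12 * d * (2 * R)\<close>, the minor bound for edges of
    length at most \<open>2 * R\<close>, is exactly the square of \<open>e\<close> over
    \<open>DIM('a)\<close>.\<close>
  define d where "d = e\<^sup>2 / (24 * R * DIM('a))"
  have d: "d > 0" using e R by (simp add: d_def)
  \<comment> \<open>The net covers a whole ball around \<open>S\<close>, because centroids of points
    of \<open>S\<close> may leave \<open>S\<close>.\<close>
  obtain N where N: "finite N" "cball (0::'a) R \<subseteq> (\<Union>c\<in>N. ball c d)"
    using compact_eq_totally_bounded[of "cball (0::'a) R"] d by auto
  define G where "G = {(i, j, c). (i::'a) \<in> Basis \<and> j \<in> Basis \<and> i \<noteq> j \<and> c \<in> N}"
  have "G \<subseteq> Basis \<times> Basis \<times> N" by (auto simp: G_def)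
  then have "finite G" by (rule finite_subset) (simp add: N)
  then obtain \<C> where \<C>: "cell_partition \<C>" "\<forall>C\<in>\<C>. (LINT x:C|lebesgue. f x) = 0"
    and cut: "\<And>C i j c. C \<in> \<C> \<Longrightarrow> (i, j, c) \<in> G \<Longrightarrow>
      \<exists>t. \<forall>x\<in>C. rotating_normal i j t \<bullet> x \<le> rotating_normal i j t \<bullet> c"
    using exists_bisecting_cell_partition[OF f zero, of G] by (fastforce simp: G_def)
  have "\<exists>a u. norm u = 1 \<and> S \<inter> C \<subseteq> cylinder a u e" if C: "C \<in> \<C>" for C
  proof (rule subset_cylinder_of_small_minors[OF e])
    fix a b z i j :: 'a
    assume abz: "a \<in> S \<inter> C" "b \<in> S \<inter> C" "z \<in> S \<inter> C" and ij: "i \<in> Basis" "j \<in> Basis"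
    have n: "norm a \<le> R" "norm b \<le> R" "norm z \<le> R" using R abz by auto
    let ?m = "(1/3) *\<^sub>R (a + b + z)"
    show "\<bar>((b - a) \<bullet> i) * ((z - a) \<bullet> j) - ((b - a) \<bullet> j) * ((z - a) \<bullet> i)\<bar> \<le> e\<^sup>2 / DIM('a)"
    proof (cases "i = j")
      case True
      then show ?thesis by simp
    next
      case False
      have "norm (a + b + z) \<le> 3 * R"
        using n norm_triangle_ineq[of "a + b" z] norm_triangle_ineq[of a b] by linarith
      then have "?m \<in> cball 0 R" by simp
      then obtain c where c: "c \<in> N" "dist ?m c \<le> d"
        using subsetD[OF N(2)] by (metis UN_E dist_commute less_imp_le mem_ball)
      then obtain t where "\<forall>x\<in>C. rotating_normal i j t \<bullet> x \<le> rotating_normal i j t \<bullet> c"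
        using cut[OF C, of i j c] ij False by (auto simp: G_def)
      moreover have "norm (b - a) \<le> 2 * R" "norm (z - a) \<le> 2 * R"
        using n norm_triangle_ineq4[of b a] norm_triangle_ineq4[of z a] by linarith+
      ultimately have "\<bar>((b - a) \<bullet> i) * ((z - a) \<bullet> j) - ((b - a) \<bullet> j) * ((z - a) \<bullet> i)\<bar> \<le> 12 * d * (2 * R)"
        using abz c(2) by (intro minor_le_of_cut_near_centroid[OF ij False]) auto
      also have "\<dots> = e\<^sup>2 / DIM('a)" using R by (simp add: d_def)
      finally show ?thesis .
    qed
  qed
  then show ?thesis using \<C> by blast
qed

section \<open>From cells to the parts of the body\<close>

text \<open>The frontiers of the finitely many cells form a negligible set, which cannot contain a
  nonempty open subset of \<open>interior S\<close>. Hence points interior to both \<open>S\<close>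
  and some cell are dense in \<open>S\<close>.\<close>

lemma compact_body_eq_Union_cells:
  fixes S :: "'a::euclidean_space set"
  assumes S: "compact_body S" and \<C>: "cell_partition \<C>"
  shows "(\<Union>C\<in>\<C>. closure (interior (S \<inter> C))) = S"
proof
  have "closed S" "S = closure (interior S)"
    using S by (auto simp: compact_body_def compact_imp_closed)
  show "(\<Union>C\<in>\<C>. closure (interior (S \<inter> C))) \<subseteq> S"
    using \<open>closed S\<close> by (meson UN_least closure_minimal inf_le1 interior_subset order_trans)
  have fin: "finite \<C>" using \<C> by (simp add: cell_partition_def)
  have neg: "negligible (\<Union>C\<in>\<C>. frontier C)"
    using \<C> fin by (intro negligible_Union) (auto simp: cell_partition_def cell_negligible_frontier)
  have "x \<in> closure (\<Union>C\<in>\<C>. interior (S \<inter> C))" if "x \<in> S" for x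
    unfolding closure_iff_nhds_not_empty
  proof (intro allI impI)
    fix A V assume "V \<subseteq> A" "open V" "x \<in> V"
    moreover have "x \<in> closure (interior S)" using that \<open>S = _\<close> by simp
    ultimately have "V \<inter> interior S \<noteq> {}"
      by (metis disjoint_iff open_Int_closure_eq_empty)
    then have "\<not> negligible (V \<inter> interior S)"
      using \<open>open V\<close> by (simp add: open_Int open_not_negligible)
    then have "\<not> V \<inter> interior S \<subseteq> (\<Union>C\<in>\<C>. frontier C)"
      using negligible_subset[OF neg] by blast
    then obtain y where y: "y \<in> V" "y \<in> interior S" "y \<notin> (\<Union>C\<in>\<C>. frontier C)"
      by blast
    have "y \<in> \<Union>\<C>" using \<C> by (simp add: cell_partition_def)
    then obtain C where C: "C \<in> \<C>" "y \<in> C" by blast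
    then have "y \<in> interior C" using y(3) closure_subset by (auto simp: frontier_def)
    then show "(\<Union>C\<in>\<C>. interior (S \<inter> C)) \<inter> A \<noteq> {}"
      using y C \<open>V \<subseteq> A\<close> by auto
  qed
  \<comment> \<open>Finiteness enters here: a finite union of closures is closed.\<close>
  moreover have "closure (\<Union>C\<in>\<C>. interior (S \<inter> C)) \<subseteq> (\<Union>C\<in>\<C>. closure (interior (S \<inter> C)))"
    by (intro closure_minimal UN_mono closure_subset closed_UN fin) auto
  ultimately show "S \<subseteq> (\<Union>C\<in>\<C>. closure (interior (S \<inter> C)))" by blast
qed

text \<open>A cell whose intersection with \<open>S\<close> has empty interior contributes the empty
  set, which is not a compact body; removing it leaves the union unchanged.\<close>

lemma decomposition_of_cell_partition:
  fixes S :: "'a::euclidean_space set"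
  assumes S: "compact_body S" and \<C>: "cell_partition \<C>"
  shows "decomposition ((\<lambda>C. closure (interior (S \<inter> C))) ` \<C> - {{}}) S"
  unfolding decomposition_def
proof (intro conjI ballI impI)
  let ?P = "\<lambda>C. closure (interior (S \<inter> C))"
  have "bounded S" using S by (simp add: compact_body_def compact_imp_bounded)
  then have bdd: "bounded (interior (S \<inter> C))" for C
    by (meson bounded_subset inf_le1 interior_subset order_trans)
  show "finite (?P ` \<C> - {{}})" using \<C> by (simp add: cell_partition_def)
  show "compact_body P" if "P \<in> ?P ` \<C> - {{}}" for P
  proof -
    from that obtain C where "P = ?P C" "P \<noteq> {}" by blast
    then show ?thesis using bdd by (auto intro!: compact_body_closure_open)
  qed
  show "\<Union>(?P ` \<C> - {{}}) = S"
  proof -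
    have "\<Union>(?P ` \<C> - {{}}) = \<Union>(?P ` \<C>)" by blast
    then show ?thesis using compact_body_eq_Union_cells[OF assms] by metis
  qed
  show "P \<inter> Q = frontier P \<inter> frontier Q"
    if P: "P \<in> ?P ` \<C> - {{}}" and Q: "Q \<in> ?P ` \<C> - {{}}" and "P \<noteq> Q" for P Q
  proof -
    obtain C where C: "C \<in> \<C>" "P = ?P C" using P by blast
    obtain D where D: "D \<in> \<C>" "Q = ?P D" using Q by blast
    have "interior C \<inter> interior D = {}"
    proof -
      have "C \<noteq> D" using C(2) D(2) \<open>P \<noteq> Q\<close> by metis
      then show ?thesis using \<C> C(1) D(1) by (simp add: cell_partition_def)
    qed
    then show ?thesis
      unfolding C(2) D(2) by (intro closure_Int_closure_eq_frontier) auto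
  qed
qed

text \<open>
  The frontier of \<open>S\<close> may carry mass of \<open>f\<close>, so it matters that the part differs from \<open>S \<inter> C\<close> only
  inside the frontier of the convex set \<open>C\<close>, which is a null set.
\<close>

lemma set_lebesgue_integral_part_eq_cell:
  fixes S :: "'a::euclidean_space set" and f :: "'a \<Rightarrow> real"
  assumes S: "compact_body S" and C: "cell C"
    and f: "integrable lebesgue f" "{x. f x \<noteq> 0} \<subseteq> S"
  shows "(LINT x:closure (interior (S \<inter> C))|lebesgue. f x) = (LINT x:C|lebesgue. f x)"
  unfolding set_lebesgue_integral_def
proof (rule integral_cong_AE)
  let ?P = "closure (interior (S \<inter> C))"
  have fm: "f \<in> borel_measurable lebesgue" using f by auto
  have "?P \<in> sets lebesgue" "C \<in> sets lebesgue"
    using cell_closed[OF C] by (auto intro: closed_imp_sets_lebesgue)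
  then show "(\<lambda>x. indicator ?P x *\<^sub>R f x) \<in> borel_measurable lebesgue"
    "(\<lambda>x. indicator C x *\<^sub>R f x) \<in> borel_measurable lebesgue"
    by (simp_all only: borel_measurable_scaleR borel_measurable_indicator fm)
  have sub: "?P \<subseteq> C"
    using cell_closed[OF C] by (meson closure_minimal inf_le2 interior_subset order_trans)
  have "AE x in lebesgue. x \<notin> frontier C"
    by (intro AE_not_in_negligible cell_negligible_frontier C)
  then show "AE x in lebesgue. indicator ?P x *\<^sub>R f x = indicator C x *\<^sub>R f x"
  proof eventually_elim
    case (elim x)
    \<comment> \<open>Such an \<open>x\<close> lies in the open set \<open>interior C\<close> and in
      the closure of \<open>interior S\<close>, hence in the closure of their intersection. Points
      outside \<open>S\<close> do not matter, since \<open>f\<close> vanishes there.\<close>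
    have "x \<in> ?P" if "x \<in> C" "x \<in> S"
    proof -
      have "x \<in> interior C" using that elim closure_subset by (auto simp: frontier_def)
      moreover have "x \<in> closure (interior S)" using that S by (auto simp: compact_body_def)
      ultimately have "x \<in> closure (interior C \<inter> interior S)"
        using open_Int_closure_subset[of "interior C" "interior S"] by auto
      then show ?thesis by (simp add: Int_commute)
    qed
    then show ?case using sub f(2) by (auto simp: indicator_def)
  qed
qed

lemma halfspace_cut_of_cell:
  "cell C \<Longrightarrow> halfspace_cut_of S (closure (interior (S \<inter> C)))"
  unfolding cell_def halfspace_cut_of_def by metis

theorem theorem2p3:
  fixes S :: "(real ^ 'n) set" and f :: "real ^ 'n \<Rightarrow> real"
  assumes "CARD('n) \<ge> 2"
    and "compact_body S"
    and "integrable lebesgue f"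
    and "{x. f x \<noteq> 0} \<subseteq> S"
    and "(\<integral>x. f x \<partial>lebesgue) = 0"
  shows "\<forall>\<epsilon>>0. \<exists>\<P>. decomposition \<P> S \<and> eps_thin \<epsilon> \<P> \<and>
           (\<forall>P\<in>\<P>. halfspace_cut_of S P \<and> (LINT x:P|lebesgue. f x) = 0)"
proof (intro allI impI)
  fix \<epsilon> :: real assume "\<epsilon> > 0"
  have "compact S" using assms(2) by (simp add: compact_body_def)
  obtain \<C> where \<C>: "cell_partition \<C>" "\<And>C. C \<in> \<C> \<Longrightarrow> (LINT x:C|lebesgue. f x) = 0"
    and thin: "\<And>C. C \<in> \<C> \<Longrightarrow> \<exists>a u. norm u = 1 \<and> S \<inter> C \<subseteq> cylinder a u \<epsilon>"
    using exists_thin_bisecting_cell_partition[OF assms(3,5) compact_imp_bounded[OF \<open>compact S\<close>] \<open>\<epsilon> > 0\<close>]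
    by blast
  have cell: "cell C" if "C \<in> \<C>" for C using \<C>(1) that by (simp add: cell_partition_def)
  let ?\<P> = "(\<lambda>C. closure (interior (S \<inter> C))) ` \<C> - {{}}"
  \<comment> \<open>Each part lies in the closed set \<open>S \<inter> C\<close> and so inherits its
    enclosing cylinder.\<close>
  have "closure (interior (S \<inter> C)) \<subseteq> S \<inter> C" if "C \<in> \<C>" for C
    using cell_closed[OF cell[OF that]] \<open>compact S\<close>
    by (intro closure_minimal interior_subset closed_Int) (auto simp: compact_imp_closed)
  then have "eps_thin \<epsilon> ?\<P>"
    using thin unfolding eps_thin_def by blast
  moreover have "halfspace_cut_of S P \<and> (LINT x:P|lebesgue. f x) = 0" if "P \<in> ?\<P>" for P
    using that halfspace_cut_of_cell[OF cell] \<C>(2)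
      set_lebesgue_integral_part_eq_cell[OF assms(2) cell assms(3,4)] by auto
  ultimately show "\<exists>\<P>. decomposition \<P> S \<and> eps_thin \<epsilon> \<P> \<and>
      (\<forall>P\<in>\<P>. halfspace_cut_of S P \<and> (LINT x:P|lebesgue. f x) = 0)"
    using decomposition_of_cell_partition[OF assms(2) \<C>(1)] by blast
qed

end
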